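(* For every integer $n \geq 15$, the graph $D_n^2$ is not a TRVG.
   Context: For $n \geq 3$, $C_n^2$ is the graph on vertex set $\{v_1,\dots,v_n\}$ in which distinct $v_i, v_j$ are adjacent if and only if $|i-j| \leq 2$ or $n-|i-j| \leq 2$. $D_n^2$ denotes the complement of $C_n^2$. A (finite, simple) graph $G$ is a transparent rectangle visibility graph (TRVG) if there is an assignment of a rectangle $R_v$ in the plane to each vertex $v$, where each $R_v$ is a nondegenerate closed rectangle with sides parallel to the coordinate axes and distinct rectangles have disjoint interiors, such that for all distinct vertices $u,v$: $u$ and $v$ are adjacent if and only if there is a horizontal line or a vertical line meeting the interiors of both $R_u$ and $R_v$. *)

theory Defs
  imports "HOL-Analysis.Analysis"
begin

text \<open>A graph is a pair of a vertex set and a set of edges, an edge being a two-element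
  set of vertices.\<close>

type_synonym 'a ugraph = "'a set \<times> 'a set set"

abbreviation verts :: "'a ugraph \<Rightarrow> 'a set" where "verts G \<equiv> fst G"

abbreviation edges :: "'a ugraph \<Rightarrow> 'a set set" where "edges G \<equiv> snd G"

definition finite_simple_graph :: "'a ugraph \<Rightarrow> bool" where
  "finite_simple_graph G \<longleftrightarrow>
     finite (verts G) \<and> (\<forall>e\<in>edges G. e \<subseteq> verts G \<and> card e = 2)"

definition adjacent :: "'a ugraph \<Rightarrow> 'a \<Rightarrow> 'a \<Rightarrow> bool" where
  "adjacent G u v \<longleftrightarrow> {u, v} \<in> edges G"

definition complement :: "'a ugraph \<Rightarrow> 'a ugraph" where
  "complement G =
     (verts G, {{u, v} | u v. u \<in> verts G \<and> v \<in> verts G \<and> u \<noteq> v \<and> \<not> adjacent G u v})"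

text \<open>The vertex \<open>v\<^sub>i\<close> is represented by its index \<open>i\<close>. Index differences are taken in the
  integers, since subtraction on the naturals truncates.\<close>

definition cycle_square :: "nat \<Rightarrow> nat ugraph" where
  "cycle_square n =
     ({1..n}, {{i, j} | i j. i \<in> {1..n} \<and> j \<in> {1..n} \<and> i \<noteq> j \<and>
        (\<bar>int i - int j\<bar> \<le> 2 \<or> int n - \<bar>int i - int j\<bar> \<le> 2)})"

definition cycle_square_complement :: "nat \<Rightarrow> nat ugraph" where
  "cycle_square_complement n = complement (cycle_square n)"

definition nondegenerate_rectangle :: "(real \<times> real) set \<Rightarrow> bool" where
  "nondegenerate_rectangle S \<longleftrightarrow>
     (\<exists>a b c d. a < b \<and> c < d \<and> S = {a..b} \<times> {c..d})"

definition horizontal_line :: "(real \<times> real) set \<Rightarrow> bool" where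
  "horizontal_line L \<longleftrightarrow> (\<exists>c. L = {p. snd p = c})"

definition vertical_line :: "(real \<times> real) set \<Rightarrow> bool" where
  "vertical_line L \<longleftrightarrow> (\<exists>c. L = {p. fst p = c})"

definition visible :: "(real \<times> real) set \<Rightarrow> (real \<times> real) set \<Rightarrow> bool" where
  "visible S T \<longleftrightarrow>
     (\<exists>L. (horizontal_line L \<or> vertical_line L) \<and>
          L \<inter> interior S \<noteq> {} \<and> L \<inter> interior T \<noteq> {})"

definition TRVG :: "'a ugraph \<Rightarrow> bool" where
  "TRVG G \<longleftrightarrow>
     (\<exists>R. (\<forall>v\<in>verts G. nondegenerate_rectangle (R v)) \<and>
          (\<forall>u\<in>verts G. \<forall>v\<in>verts G. u \<noteq> v \<longrightarrow>
             interior (R u) \<inter> interior (R v) = {} \<and>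
             (adjacent G u v \<longleftrightarrow> visible (R u) (R v))))"

lemma finite_simple_graph_cycle_square: "finite_simple_graph (cycle_square n)"
  by (auto simp: finite_simple_graph_def cycle_square_def)

lemma finite_simple_graph_complement:
  "finite_simple_graph G \<Longrightarrow> finite_simple_graph (complement G)"
  by (auto simp: finite_simple_graph_def complement_def)

lemma finite_simple_graph_cycle_square_complement:
  "finite_simple_graph (cycle_square_complement n)"
  by (simp add: cycle_square_complement_def finite_simple_graph_complement
      finite_simple_graph_cycle_square)

lemma adjacent_cycle_square_iff:
  assumes "i \<in> {1..n}" "j \<in> {1..n}" "i \<noteq> j"
  shows "adjacent (cycle_square n) i j \<longleftrightarrow>
    \<bar>int i - int j\<bar> \<le> 2 \<or> int n - \<bar>int i - int j\<bar> \<le> 2"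
  using assms by (auto simp: adjacent_def cycle_square_def doubleton_eq_iff abs_minus_commute)

lemma adjacent_complement_iff:
  assumes "u \<in> verts G" "v \<in> verts G" "u \<noteq> v"
  shows "adjacent (complement G) u v \<longleftrightarrow> \<not> adjacent G u v"
  using assms by (auto simp: adjacent_def complement_def doubleton_eq_iff insert_commute)

end

theory Submission
  imports Defs
begin

text \<open>The projections of the rectangles to the two axes turn a TRVG representation into two interval
  orders on the vertices such that any two vertices are comparable in at least one of them, and
  adjacent exactly if they are incomparable in the other. For \<open>n \<ge> 15\<close> the triples \<open>{1, 2, 3}\<close>,
  \<open>{6, 7, 8}\<close> and \<open>{11, 12, 13}\<close> induce a \<open>K\<^sub>3\<^sub>,\<^sub>3\<^sub>,\<^sub>3\<close> in \<open>D\<^sub>n\<^sup>2\<close>, and no two interval orders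
  represent \<open>K\<^sub>3\<^sub>,\<^sub>3\<^sub>,\<^sub>3\<close>: once each triple is listed along the first order, this is a
  finite problem that an SMT solver refutes after a short case analysis.\<close>

text \<open>Fishburn's axioms: irreflexivity and no \<open>2 + 2\<close>. Transitivity is the case
  \<open>w = v\<close>.\<close>

definition interval_order :: "('a \<Rightarrow> 'a \<Rightarrow> bool) \<Rightarrow> bool" where
  "interval_order P \<longleftrightarrow>
     (\<forall>u. \<not> P u u) \<and> (\<forall>u v w z. P u v \<longrightarrow> P w z \<longrightarrow> P u z \<or> P w v)"

definition comparable :: "('a \<Rightarrow> 'a \<Rightarrow> bool) \<Rightarrow> 'a \<Rightarrow> 'a \<Rightarrow> bool" where
  "comparable P u v \<longleftrightarrow> P u v \<or> P v u"

text \<open>If \<open>l v \<le> l z\<close>, then \<open>r u \<le> l v \<le> l z\<close>; otherwise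
  \<open>r w \<le> l z \<le> l v\<close>.\<close>

lemma interval_order_intervals:
  fixes l r :: "'a \<Rightarrow> 'b::linorder"
  assumes "\<And>v. l v < r v"
  shows "interval_order (\<lambda>u v. r u \<le> l v)"
  unfolding interval_order_def by (meson assms leD le_cases order_trans)

text \<open>A tournament on three vertices has a Hamiltonian path.\<close>

lemma comparable_triple_path:
  assumes "comparable P x y" "comparable P x z" "comparable P y z"
  obtains a b c where "{a, b, c} = {x, y, z}" "P a b" "P b c"
proof -
  have "{x, z, y} = {x, y, z}" "{y, x, z} = {x, y, z}" "{y, z, x} = {x, y, z}"
    "{z, x, y} = {x, y, z}" "{z, y, x} = {x, y, z}"
    by auto
  then show thesis
    using assms that[of x y z] that[of x z y] that[of y x z] that[of y z x] that[of z x y]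
      that[of z y x] unfolding comparable_def by argo
qed

text \<open>The vertical line at abscissa \<open>c\<close> meets a set iff \<open>c\<close> lies in
  its first projection; likewise for horizontal lines and second projections.\<close>

lemma visible_iff:
  "visible S T \<longleftrightarrow>
    fst ` interior S \<inter> fst ` interior T \<noteq> {} \<or> snd ` interior S \<inter> snd ` interior T \<noteq> {}"
proof -
  have "fst ` A \<inter> fst ` B \<noteq> {} \<longleftrightarrow>
      (\<exists>c. {p. fst p = c} \<inter> A \<noteq> {} \<and> {p. fst p = c} \<inter> B \<noteq> {})" for A B :: "(real \<times> real) set"
    by blast
  moreover have "snd ` A \<inter> snd ` B \<noteq> {} \<longleftrightarrow>
      (\<exists>c. {p. snd p = c} \<inter> A \<noteq> {} \<and> {p. snd p = c} \<inter> B \<noteq> {})" for A B :: "(real \<times> real) set"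
    by blast
  ultimately show ?thesis
    unfolding visible_def horizontal_line_def vertical_line_def by metis
qed

lemma disjoint_open_intervals_iff:
  fixes a b c d :: real
  assumes "a < b" "c < d"
  shows "{a<..<b} \<inter> {c<..<d} = {} \<longleftrightarrow> b \<le> c \<or> d \<le> a"
proof -
  have "{a<..<b} \<inter> {c<..<d} = {max a c<..<min b d}"
    by auto
  then show ?thesis
    using assms by auto
qed

lemma TRVG_interval_orders:
  assumes "TRVG G"
  obtains P Q where "interval_order P" "interval_order Q"
    "\<And>u v. \<lbrakk>u \<in> verts G; v \<in> verts G; u \<noteq> v\<rbrakk> \<Longrightarrow> comparable P u v \<or> comparable Q u v"
    "\<And>u v. \<lbrakk>u \<in> verts G; v \<in> verts G; u \<noteq> v\<rbrakk> \<Longrightarrow>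
      adjacent G u v \<longleftrightarrow> \<not> (comparable P u v \<and> comparable Q u v)"
proof -
  obtain R where nondeg: "\<forall>v\<in>verts G. nondegenerate_rectangle (R v)"
    and R: "\<forall>u\<in>verts G. \<forall>v\<in>verts G. u \<noteq> v \<longrightarrow>
      interior (R u) \<inter> interior (R v) = {} \<and> (adjacent G u v \<longleftrightarrow> visible (R u) (R v))"
    using assms unfolding TRVG_def by (elim exE conjE) (rule that)
  \<comment> \<open>Non-vertices get a dummy nondegenerate box, so that \<open>P\<close> and
    \<open>Q\<close> are interval orders on the whole type.\<close>
  have "\<exists>a b c d. a < b \<and> c < d \<and> (v \<in> verts G \<longrightarrow> R v = {a..b} \<times> {c..d})" for v
  proof (cases "v \<in> verts G")
    case True
    then show ?thesis
      using nondeg unfolding nondegenerate_rectangle_def by blast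
  next
    case False
    then show ?thesis
      using zero_less_one by blast
  qed
  then obtain a b c d where bounds: "\<And>v. a v < b v" "\<And>v. c v < d v"
    and Rv: "\<And>v. v \<in> verts G \<Longrightarrow> R v = {a v..b v} \<times> {c v..d v}"
    by metis
  define P where "P = (\<lambda>u v. b u \<le> a v)"
  define Q where "Q = (\<lambda>u v. d u \<le> c v)"
  have P: "{a u<..<b u} \<inter> {a v<..<b v} = {} \<longleftrightarrow> comparable P u v" for u v
    unfolding comparable_def P_def by (intro disjoint_open_intervals_iff bounds)
  have Q: "{c u<..<d u} \<inter> {c v<..<d v} = {} \<longleftrightarrow> comparable Q u v" for u v
    unfolding comparable_def Q_def by (intro disjoint_open_intervals_iff bounds)
  have proj: "fst ` interior (R v) = {a v<..<b v}" "snd ` interior (R v) = {c v<..<d v}"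
    if "v \<in> verts G" for v
    using that bounds[of v] by (simp_all add: Rv interior_Times)
  show thesis
  proof
    show "interval_order P" "interval_order Q"
      unfolding P_def Q_def using bounds by (auto intro!: interval_order_intervals)
    fix u v assume uv: "u \<in> verts G" "v \<in> verts G" "u \<noteq> v"
    then have "interior (R u) \<inter> interior (R v) = {}"
      using R by blast
    \<comment> \<open>A product of open intervals is empty iff a factor is, so disjoint interiors
      force disjoint projections on some axis.\<close>
    then show "comparable P u v \<or> comparable Q u v"
      using uv by (simp add: Rv interior_Times Times_Int_Times Times_empty P Q
          del: Int_greaterThanLessThan)
    have "adjacent G u v \<longleftrightarrow> visible (R u) (R v)"
      using R uv by blast
    then show "adjacent G u v \<longleftrightarrow> \<not> (comparable P u v \<and> comparable Q u v)"
      using uv by (simp add: visible_iff proj P Q del: Int_greaterThanLessThan)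
  qed
qed

text \<open>Since each triple is a chain in both orders, \<open>swap\<close> forbids two members of
  one triple from both being incomparable, in the same order, to two members of another. The search
  is over which order separates each of the 27 cross pairs. Listing the triples along
  \<open>P\<close> fixes directions there; those in \<open>Q\<close> stay open.\<close>

lemma no_interval_orders_K333_sorted:
  assumes "interval_order P" "interval_order Q"
    and P: "P a1 a2" "P a2 a3" "P b1 b2" "P b2 b3" "P c1 c2" "P c2 c3"
    and Q: "comparable Q a1 a2" "comparable Q a1 a3" "comparable Q a2 a3"
      "comparable Q b1 b2" "comparable Q b1 b3" "comparable Q b2 b3"
      "comparable Q c1 c2" "comparable Q c1 c3" "comparable Q c2 c3"
    and AB: "\<And>a b. \<lbrakk>a \<in> {a1, a2, a3}; b \<in> {b1, b2, b3}\<rbrakk> \<Longrightarrow> comparable P a b \<noteq> comparable Q a b"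
    and AC: "\<And>a c. \<lbrakk>a \<in> {a1, a2, a3}; c \<in> {c1, c2, c3}\<rbrakk> \<Longrightarrow> comparable P a c \<noteq> comparable Q a c"
    and BC: "\<And>b c. \<lbrakk>b \<in> {b1, b2, b3}; c \<in> {c1, c2, c3}\<rbrakk> \<Longrightarrow> comparable P b c \<noteq> comparable Q b c"
  shows False
proof -
  have irrefl: "\<And>u. \<not> P u u" "\<And>u. \<not> Q u u"
    and swap: "\<And>u v w z. P u v \<Longrightarrow> P w z \<Longrightarrow> P u z \<or> P w v"
      "\<And>u v w z. Q u v \<Longrightarrow> Q w z \<Longrightarrow> Q u z \<or> Q w v"
    using assms(1,2) unfolding interval_order_def by blast+
  note cross = AB AC BC
  show False
    \<comment> \<open>Unfolding membership leaves only equations between elements, so the solver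
      sees no sets.\<close>
    using irrefl swap P Q[unfolded comparable_def]
      cross[unfolded comparable_def insert_iff empty_iff]
    by (smt (z3))
qed

lemma clique_triple_path:
  assumes "distinct [x, y, z]"
    and clique: "\<And>u v. \<lbrakk>u \<in> {x, y, z}; v \<in> {x, y, z}; u \<noteq> v\<rbrakk> \<Longrightarrow> comparable P u v \<and> comparable Q u v"
  obtains a b c where "{a, b, c} = {x, y, z}" "P a b" "P b c"
    "comparable Q a b" "comparable Q a c" "comparable Q b c"
proof -
  have "comparable P x y" "comparable P x z" "comparable P y z"
    using assms(1) by (simp_all add: clique)
  then obtain a b c where abc: "{a, b, c} = {x, y, z}" "P a b" "P b c"
    by (rule comparable_triple_path)
  \<comment> \<open>Counting shows that the reordered names are still distinct, as
    \<open>clique\<close> requires.\<close>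
  have "card {a, b, c} = 3"
    unfolding abc(1) using assms(1) by simp
  then have "a \<noteq> b" "a \<noteq> c" "b \<noteq> c"
    by (auto simp: card_insert_if split: if_splits)
  then show thesis
    by (intro that[OF abc] clique[folded abc(1), THEN conjunct2]) simp_all
qed

text \<open>The hypotheses depend only on the three sets, so each triple may be relabelled along a
  \<open>P\<close>-path.\<close>

lemma no_interval_orders_K333:
  assumes orders: "interval_order P" "interval_order Q"
    and distinct: "distinct [a1, a2, a3]" "distinct [b1, b2, b3]" "distinct [c1, c2, c3]"
    and A: "\<And>u v. \<lbrakk>u \<in> {a1, a2, a3}; v \<in> {a1, a2, a3}; u \<noteq> v\<rbrakk> \<Longrightarrow> comparable P u v \<and> comparable Q u v"
    and B: "\<And>u v. \<lbrakk>u \<in> {b1, b2, b3}; v \<in> {b1, b2, b3}; u \<noteq> v\<rbrakk> \<Longrightarrow> comparable P u v \<and> comparable Q u v"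
    and C: "\<And>u v. \<lbrakk>u \<in> {c1, c2, c3}; v \<in> {c1, c2, c3}; u \<noteq> v\<rbrakk> \<Longrightarrow> comparable P u v \<and> comparable Q u v"
    and AB: "\<And>a b. \<lbrakk>a \<in> {a1, a2, a3}; b \<in> {b1, b2, b3}\<rbrakk> \<Longrightarrow> comparable P a b \<noteq> comparable Q a b"
    and AC: "\<And>a c. \<lbrakk>a \<in> {a1, a2, a3}; c \<in> {c1, c2, c3}\<rbrakk> \<Longrightarrow> comparable P a c \<noteq> comparable Q a c"
    and BC: "\<And>b c. \<lbrakk>b \<in> {b1, b2, b3}; c \<in> {c1, c2, c3}\<rbrakk> \<Longrightarrow> comparable P b c \<noteq> comparable Q b c"
  shows False
proof -
  obtain x1 x2 x3 where x: "{x1, x2, x3} = {a1, a2, a3}" "P x1 x2" "P x2 x3"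
      "comparable Q x1 x2" "comparable Q x1 x3" "comparable Q x2 x3"
    using distinct(1) A by (rule clique_triple_path)
  obtain y1 y2 y3 where y: "{y1, y2, y3} = {b1, b2, b3}" "P y1 y2" "P y2 y3"
      "comparable Q y1 y2" "comparable Q y1 y3" "comparable Q y2 y3"
    using distinct(2) B by (rule clique_triple_path)
  obtain z1 z2 z3 where z: "{z1, z2, z3} = {c1, c2, c3}" "P z1 z2" "P z2 z3"
      "comparable Q z1 z2" "comparable Q z1 z3" "comparable Q z2 z3"
    using distinct(3) C by (rule clique_triple_path)
  show False
    by (rule no_interval_orders_K333_sorted[OF orders x(2,3) y(2,3) z(2,3) x(4-6) y(4-6) z(4-6)
          AB[folded x(1) y(1)] AC[folded x(1) z(1)] BC[folded y(1) z(1)]])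
qed

theorem theorem6:
  fixes n :: nat
  assumes "n \<ge> 15"
  shows "\<not> TRVG (cycle_square_complement n)"
proof
  let ?G = "cycle_square_complement n"
  have verts: "verts ?G = {1..n}" "verts (cycle_square n) = {1..n}"
    by (simp_all add: cycle_square_complement_def complement_def cycle_square_def)
  have adj: "adjacent ?G i j \<longleftrightarrow> \<bar>int i - int j\<bar> > 2 \<and> int n - \<bar>int i - int j\<bar> > 2"
    if "i \<in> {1..n}" "j \<in> {1..n}" "i \<noteq> j" for i j
    using that adjacent_complement_iff[of i "cycle_square n" j] verts
    by (auto simp: cycle_square_complement_def adjacent_cycle_square_iff)
  assume "TRVG ?G"
  then obtain P Q where orders: "interval_order P" "interval_order Q"
    and PQ: "\<And>i j. \<lbrakk>i \<in> {1..n}; j \<in> {1..n}; i \<noteq> j\<rbrakk> \<Longrightarrow> comparable P i j \<or> comparable Q i j"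
      "\<And>i j. \<lbrakk>i \<in> {1..n}; j \<in> {1..n}; i \<noteq> j\<rbrakk> \<Longrightarrow>
        adjacent ?G i j \<longleftrightarrow> \<not> (comparable P i j \<and> comparable Q i j)"
    unfolding verts(1)[symmetric] by (rule TRVG_interval_orders) blast
  have close: "comparable P i j \<and> comparable Q i j"
    if "i \<in> {1..n}" "j \<in> {1..n}" "i \<noteq> j" "\<bar>int i - int j\<bar> \<le> 2" for i j
    using PQ(2)[OF that(1-3)] adj[OF that(1-3)] that(4) by linarith
  \<comment> \<open>Adjacency excludes comparability in both orders, disjointness of interiors
    excludes it in neither.\<close>
  have far: "comparable P i j \<noteq> comparable Q i j"
    if "i \<in> {1..n}" "j \<in> {1..n}" "\<bar>int i - int j\<bar> > 2" "int n - \<bar>int i - int j\<bar> > 2" for i j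
  proof -
    have "i \<noteq> j"
      using that(3) by auto
    then show ?thesis
      using PQ[of i j] adj[of i j] that by auto
  qed
  show False
  \<comment> \<open>Indices within a triple differ by at most 2, across triples by 3 (such as 3 and
    6) to 12 (1 and 13). The largest gap needs \<open>n - 12 > 2\<close>, that is,
    \<open>n \<ge> 15\<close>.\<close>
  proof (rule no_interval_orders_K333[OF orders, of 1 2 3 6 7 8 11 12 13])
    fix i j :: nat
    assume "i \<in> {1, 2, 3}" "j \<in> {1, 2, 3}" "i \<noteq> j"
    then show "comparable P i j \<and> comparable Q i j"
      using assms by (intro close) auto
  next
    fix i j :: nat
    assume "i \<in> {6, 7, 8}" "j \<in> {6, 7, 8}" "i \<noteq> j"
    then show "comparable P i j \<and> comparable Q i j"
      using assms by (intro close) auto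
  next
    fix i j :: nat
    assume "i \<in> {11, 12, 13}" "j \<in> {11, 12, 13}" "i \<noteq> j"
    then show "comparable P i j \<and> comparable Q i j"
      using assms by (intro close) auto
  next
    fix i j :: nat
    assume "i \<in> {1, 2, 3}" "j \<in> {6, 7, 8}"
    then show "comparable P i j \<noteq> comparable Q i j"
      using assms by (intro far) auto
  next
    fix i j :: nat
    assume "i \<in> {1, 2, 3}" "j \<in> {11, 12, 13}"
    then show "comparable P i j \<noteq> comparable Q i j"
      using assms by (intro far) auto
  next
    fix i j :: nat
    assume "i \<in> {6, 7, 8}" "j \<in> {11, 12, 13}"
    then show "comparable P i j \<noteq> comparable Q i j"
      using assms by (intro far) auto
  qed simp_all
qed

end
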